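(* Let $d\ge 2$, $r>0$, and let $f:\mathbb{Z}^d\to\mathbb{C}$ satisfy $\operatorname{supp} f\subseteq B_r\cap\mathbb{Z}^d$. Let the lines $\gamma_z$ ($z\in\mathbb{Z}^d$), the family $\mathcal{T}^\star=\{\gamma_z: z\in\mathbb{Z}^d\}$, and the sets $\mathcal{A}_{\alpha,\beta}$, $\mathcal{T}^\star_{\alpha,\beta}$ be as defined in the context. Then: (i) $\mathcal{P}f$ on $\mathcal{T}^\star$ uniquely determines $f$. (ii) This determination is given by the following formulas. For each $(z_3,\dots,z_d)\in\mathbb{Z}^{d-2}$ let $\Xi=\{(x_1,x_2,z_3,\dots,z_d): (x_1,x_2)\in\mathbb{R}^2\}$ and $x_0=(0,0,z_3,\dots,z_d)$ (for $d=2$: $\Xi=\mathbb{R}^2$, $x_0=0$). If $B_r\cap\Xi\cap\mathbb{Z}^d\neq\emptyset$, let $S_1,\dots,S_J$ be the layers of $B_r\cap\Xi\cap\mathbb{Z}^d$ with respect to $x_0$, as defined in the context. Then $$f(z)=\mathcal{P}f(\gamma_z),\quad z\in S_1,$$ $$f(z)=\mathcal{P}f(\gamma_z)-\sum_{\zeta\in\gamma_z\cap(\cup_{k=1}^{i}S_k)}f(\zeta),\quad z\in S_{i+1},\quad i=1,\dots,J-1.$$ (iii) For all $0\le\alpha\le\beta$ with $\beta\ge r$, $\mathcal{P}f$ on $\mathcal{T}^\star_{\alpha,\beta}$ uniquely determines $f$ on $\mathcal{A}_{\alpha,\beta}$.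
   Context: $B_r=\{x\in\mathbb{R}^d: |x|\le r\}$. An oriented line (ray) $\gamma=(\theta,x)$ is the line $\{x+t\theta: t\in\mathbb{R}\}$ with orientation (direction) $\theta\in\mathbb{S}^{d-1}$, where $x\in\mathbb{R}^d$, $x\cdot\theta=0$. For an oriented line $\gamma$ containing at least one point of $\mathbb{Z}^d$, the discrete X-ray transform is $\mathcal{P}f(\gamma)=\sum_{y\in\gamma\cap\mathbb{Z}^d}f(y)$. $\Omega=\{z/|z|: z\in\mathbb{Z}^d\setminus\{0\}\}$. Fix some $\theta\in\Omega$ of the form $\theta=(\theta_1,\theta_2,0,\dots,0)$. Let $e_1,\dots,e_d$ be the standard basis of $\mathbb{R}^d$. For $z=(z_1,\dots,z_d)\in\mathbb{Z}^d$: - if $z_1^2+z_2^2\ne0$, then $\gamma_z=\{z+t\hat z_\star: t\in\mathbb{R}\}$ with direction $\hat z_\star=\dfrac{-z_2e_1+z_1e_2}{\sqrt{z_1^2+z_2^2}}$; - if $z_1^2+z_2^2=0$, then $\gamma_z=\{z+t\theta: t\in\mathbb{R}\}$ with direction $\theta$. For $0\le\alpha\le\beta$: $\mathcal{A}_{\alpha,\beta}=\{z\in\mathbb{Z}^d: \alpha\le\sqrt{z_1^2+z_2^2}\le\beta\}$ and $\mathcal{T}^\star_{\alpha,\beta}=\{\gamma_z: z\in\mathbb{Z}^d,\ \alpha\le\sqrt{z_1^2+z_2^2}\le\beta\}$. Layers: for a finite nonempty set $E\subset\mathbb{R}^d$ and a point $x_0$, the layers $S_1,\dots,S_J$ of $E$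 with respect to $x_0$ are defined inductively by $S_1=\{z\in E: |z-x_0|\ge|\zeta-x_0|\ \forall\zeta\in E\}$ and $S_{i+1}=\{z\in E\setminus\cup_{k=1}^iS_k: |z-x_0|\ge|\zeta-x_0|\ \forall\zeta\in E\setminus\cup_{k=1}^iS_k\}$, where $J$ is the number of nonempty sets so obtained; thus $E$ is the disjoint union of $S_1,\dots,S_J$, ordered by strictly decreasing distance to $x_0$. "$\mathcal{P}f$ on a set of lines uniquely determines $f$ (on a set $A$)" means: if two functions on $\mathbb{Z}^d$, both supported in $B_r\cap\mathbb{Z}^d$, have the same $\mathcal{P}$ on all lines in that set, then they coincide (on $A$). *)

theory Defs
  imports "HOL-Analysis.Analysis"
begin

text \<open>
  The lattice of integer points is the type \<open>int ^ 'd\<close>, embedded into \<open>real ^ 'd\<close> by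
  \<open>lat\<close>. The index type \<open>'d\<close> carries no order, so the first two coordinates are passed
  around as two distinct indices \<open>p\<close> and \<open>q\<close>; their existence is equivalent to
  \<open>CARD('d) \<ge> 2\<close>.
\<close>

definition lat :: "int ^ 'd \<Rightarrow> real ^ 'd" where
  "lat z = (\<chi> k. real_of_int (z $ k))"

text \<open>
  An oriented line is a pair \<open>(\<theta>, x)\<close> of its direction and its point orthogonal to the
  direction.
\<close>

type_synonym 'd ray = "(real ^ 'd) \<times> (real ^ 'd)"

definition is_ray :: "'d::finite ray \<Rightarrow> bool" where
  "is_ray \<gamma> \<longleftrightarrow> norm (fst \<gamma>) = 1 \<and> snd \<gamma> \<bullet> fst \<gamma> = 0"

definition ray_points :: "'d::finite ray \<Rightarrow> (real ^ 'd) set" where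
  "ray_points \<gamma> = {snd \<gamma> + t *\<^sub>R fst \<gamma> | t. True}"

text \<open>
  A line may contain infinitely many lattice points, so the transform is an unordered
  infinite sum; it has only finitely many nonzero terms if \<open>f\<close> has bounded support.
\<close>

definition xray :: "(int ^ 'd::finite \<Rightarrow> complex) \<Rightarrow> 'd ray \<Rightarrow> complex" where
  "xray f \<gamma> = (\<Sum>\<^sub>\<infinity>y\<in>{y. lat y \<in> ray_points \<gamma>}. f y)"

definition supported_in_ball :: "real \<Rightarrow> (int ^ 'd::finite \<Rightarrow> complex) \<Rightarrow> bool" where
  "supported_in_ball r f \<longleftrightarrow> lat ` {z. f z \<noteq> 0} \<subseteq> cball 0 r"

definition rational_directions :: "(real ^ 'd::finite) set" where
  "rational_directions = {lat z /\<^sub>R norm (lat z) | z. z \<noteq> 0}"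

definition planar_radius :: "'d \<Rightarrow> 'd \<Rightarrow> int ^ 'd \<Rightarrow> real" where
  "planar_radius p q z = sqrt ((real_of_int (z $ p))\<^sup>2 + (real_of_int (z $ q))\<^sup>2)"

definition star_direction :: "'d \<Rightarrow> 'd \<Rightarrow> int ^ 'd::finite \<Rightarrow> real ^ 'd" where
  "star_direction p q z =
     (- real_of_int (z $ q) *\<^sub>R axis p 1 + real_of_int (z $ p) *\<^sub>R axis q 1) /\<^sub>R planar_radius p q z"

definition star_ray :: "'d \<Rightarrow> 'd \<Rightarrow> real ^ 'd \<Rightarrow> int ^ 'd::finite \<Rightarrow> 'd ray" where
  "star_ray p q \<theta> z =
     (if (z $ p)\<^sup>2 + (z $ q)\<^sup>2 \<noteq> 0 then (star_direction p q z, lat z) else (\<theta>, lat z))"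

definition star_rays :: "'d \<Rightarrow> 'd \<Rightarrow> real ^ 'd \<Rightarrow> 'd::finite ray set" where
  "star_rays p q \<theta> = {star_ray p q \<theta> z | z. True}"

definition annulus :: "'d \<Rightarrow> 'd \<Rightarrow> real \<Rightarrow> real \<Rightarrow> (int ^ 'd) set" where
  "annulus p q \<alpha> \<beta> = {z. \<alpha> \<le> planar_radius p q z \<and> planar_radius p q z \<le> \<beta>}"

definition star_rays_between ::
    "'d \<Rightarrow> 'd \<Rightarrow> real ^ 'd \<Rightarrow> real \<Rightarrow> real \<Rightarrow> 'd::finite ray set" where
  "star_rays_between p q \<theta> \<alpha> \<beta> =
     {star_ray p q \<theta> z | z. \<alpha> \<le> planar_radius p q z \<and> planar_radius p q z \<le> \<beta>}"

definition uniquely_determines_on ::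
    "real \<Rightarrow> 'd::finite ray set \<Rightarrow> (int ^ 'd) set \<Rightarrow> bool" where
  "uniquely_determines_on r L A \<longleftrightarrow>
     (\<forall>f g. supported_in_ball r f \<longrightarrow> supported_in_ball r g \<longrightarrow>
        (\<forall>\<gamma>\<in>L. xray f \<gamma> = xray g \<gamma>) \<longrightarrow> (\<forall>z\<in>A. f z = g z))"

text \<open>
  Layers are numbered from 1. Only finite nonempty sets \<open>E\<close> and indices \<open>i \<ge> 1\<close> are
  meaningful (the value at index 0 happens to equal the first layer).
\<close>

function layer :: "'a::real_normed_vector set \<Rightarrow> 'a \<Rightarrow> nat \<Rightarrow> 'a set" where
  "layer E x0 i =
     {z \<in> E - (\<Union>k\<in>{1..<i}. layer E x0 k).
        \<forall>\<zeta> \<in> E - (\<Union>k\<in>{1..<i}. layer E x0 k). norm (z - x0) \<ge> norm (\<zeta> - x0)}"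
  by auto
termination by (relation "Wellfounded.measure (\<lambda>(E, x0, i). i)") auto

declare layer.simps [simp del]

definition layer_count :: "'a::real_normed_vector set \<Rightarrow> 'a \<Rightarrow> nat" where
  "layer_count E x0 = card {i. 1 \<le> i \<and> layer E x0 i \<noteq> {}}"

text \<open>
  The tuple \<open>(z\<^sub>3, \<dots>, z\<^sub>d)\<close> is given as the integer vector \<open>c = (0, 0, z\<^sub>3, \<dots>, z\<^sub>d)\<close>; then
  \<open>x\<^sub>0 = lat c\<close>, and \<open>planar_slice p q c\<close> is the plane \<open>\<Xi>\<close>.
\<close>

definition planar_slice :: "'d \<Rightarrow> 'd \<Rightarrow> int ^ 'd \<Rightarrow> (real ^ 'd) set" where
  "planar_slice p q c = {x. \<forall>k. k \<noteq> p \<and> k \<noteq> q \<longrightarrow> x $ k = real_of_int (c $ k)}"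

text \<open>
  The pairs \<open>star_ray p q \<theta> z\<close> are oriented lines in the above sense, and \<open>lat z\<close> lies on them.
\<close>

lemma is_ray_star_ray:
  assumes pq: "p \<noteq> q" and \<theta>: "\<theta> \<in> rational_directions"
    and planar: "\<forall>k. k \<noteq> p \<and> k \<noteq> q \<longrightarrow> \<theta> $ k = 0"
  shows "is_ray (star_ray p q \<theta> z)"
proof (cases "(z $ p)\<^sup>2 + (z $ q)\<^sup>2 = 0")
  case True
  then have "z $ p = 0" "z $ q = 0" by (auto simp: sum_power2_eq_zero_iff)
  then have "lat z \<bullet> \<theta> = 0"
    unfolding inner_vec_def lat_def using planar by (intro sum.neutral) auto
  moreover have "norm \<theta> = 1"
  proof -
    obtain w :: "int ^ 'a" where w: "w \<noteq> 0" "\<theta> = lat w /\<^sub>R norm (lat w)"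
      using \<theta> by (auto simp: rational_directions_def)
    then have "lat w \<noteq> 0" by (auto simp: lat_def vec_eq_iff)
    with w show ?thesis by simp
  qed
  ultimately show ?thesis using True by (simp add: is_ray_def star_ray_def)
next
  case False
  let ?R = "planar_radius p q z"
  have R: "?R > 0" using False
    by (auto simp: planar_radius_def sum_power2_eq_zero_iff sum_power2_gt_zero_iff)
  have n: "norm (- real_of_int (z $ q) *\<^sub>R axis p 1 + real_of_int (z $ p) *\<^sub>R axis q 1
      :: real ^ 'a) = ?R"
    using pq by (simp add: norm_eq_sqrt_inner planar_radius_def inner_add_left inner_add_right
        inner_diff_left inner_diff_right inner_axis_axis power2_eq_square algebra_simps)
  have "norm (star_direction p q z) = 1"
    unfolding star_direction_def using R n by simp
  moreover have "lat z \<bullet> star_direction p q z = 0"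
    by (simp add: star_direction_def inner_add_right inner_diff_right inner_axis lat_def)
  ultimately show ?thesis using False by (simp add: is_ray_def star_ray_def)
qed

lemma lat_mem_star_ray: "lat z \<in> ray_points (star_ray p q \<theta> z)"
  by (auto simp: ray_points_def star_ray_def intro!: exI[of _ 0])

end

theory Submission
  imports Defs
begin

text \<open>
  Consider the plane through a lattice point \<open>z\<close> parallel to the \<open>p\<close>-\<open>q\<close> coordinate plane, and its
  point \<open>x\<^sub>0\<close> with \<open>p\<close>- and \<open>q\<close>-coordinates 0. The line attached to \<open>z\<close> lies in this plane and is
  tangent at \<open>z\<close> to the circle around \<open>x\<^sub>0\<close> through \<open>z\<close>; if \<open>z = x\<^sub>0\<close>, it is a line through the
  centre. By Pythagoras, every other point of the line is strictly farther from \<open>x\<^sub>0\<close>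
  (\<open>planar_radius_less_on_star_ray\<close>). So the transform of \<open>f\<close> along this line is \<open>f z\<close> plus
  values of \<open>f\<close> at lattice points of larger planar radius. Only the finitely many lattice points
  of the ball matter, so \<open>f\<close> is recovered by a recursion from the outside to the centre.

  Uniqueness is an induction along decreasing planar radius. A point of the ball has planar radius
  at most \<open>r\<close>, so for \<open>r \<le> \<beta>\<close> the recursion started in \<open>annulus p q \<alpha> \<beta>\<close> only uses values of \<open>f\<close>
  in this annulus (\<open>uniquely_determines_on_annulus\<close>). For the reconstruction formulas, the
  distance to \<open>x\<^sub>0\<close> within a slice is the planar radius, so the lattice points of the line that lie
  in the ball, other than \<open>z\<close>, are exactly those in earlier layers than \<open>z\<close>
  (\<open>layer_reconstruction\<close>).
\<close>

lemma lat_eq_iff [simp]: "lat y = lat z \<longleftrightarrow> y = z"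
  by (simp add: lat_def vec_eq_iff)

lemma finite_lattice_cball: "finite {z :: int ^ 'd::finite. lat z \<in> cball 0 r}"
proof -
  let ?F = "{- \<lfloor>r\<rfloor>..\<lfloor>r\<rfloor>}"
  have "{z :: int ^ 'd. lat z \<in> cball 0 r} \<subseteq> vec_lambda ` (UNIV \<rightarrow>\<^sub>E ?F)"
  proof
    fix z :: "int ^ 'd" assume "z \<in> {z. lat z \<in> cball 0 r}"
    then have "norm (lat z) \<le> r" by simp
    then have "\<bar>real_of_int (z $ k)\<bar> \<le> r" for k
      using component_le_norm_cart[of "lat z" k] by (simp add: lat_def)
    then have "z $ k \<le> \<lfloor>r\<rfloor>" "- (z $ k) \<le> \<lfloor>r\<rfloor>" for k
      by (simp_all add: le_floor_iff abs_le_iff minus_le_iff)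
    then have "z $ k \<in> ?F" for k
      by (simp add: minus_le_iff)
    then have "vec_nth z \<in> UNIV \<rightarrow>\<^sub>E ?F" by auto
    then show "z \<in> vec_lambda ` (UNIV \<rightarrow>\<^sub>E ?F)"
      by (metis image_eqI vec_nth_inverse)
  qed
  then show ?thesis
    by (rule finite_subset) (intro finite_imageI finite_PiE; simp)
qed

lemma xray_eq_sum:
  assumes "supported_in_ball r f"
  shows "xray f \<gamma> = (\<Sum>y | lat y \<in> ray_points \<gamma> \<inter> cball 0 r. f y)"
proof -
  have "xray f \<gamma> = infsum f {y. lat y \<in> ray_points \<gamma> \<inter> cball 0 r}"
    unfolding xray_def using assms
    by (intro infsum_cong_neutral) (auto simp: supported_in_ball_def)
  also have "\<dots> = (\<Sum>y | lat y \<in> ray_points \<gamma> \<inter> cball 0 r. f y)"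
    by (rule infsum_finite) (rule finite_subset[OF _ finite_lattice_cball[of r]], auto)
  finally show ?thesis .
qed

lemma inner_planar:
  fixes u v :: "real ^ 'd::finite"
  assumes "p \<noteq> q" and "\<And>k. k \<noteq> p \<Longrightarrow> k \<noteq> q \<Longrightarrow> u $ k = 0"
  shows "v \<bullet> u = v $ p * u $ p + v $ q * u $ q"
proof -
  have "v \<bullet> u = (\<Sum>k\<in>{p, q}. v $ k * u $ k)"
    unfolding inner_vec_def inner_real_def by (rule sum.mono_neutral_right) (simp_all add: assms(2))
  with assms(1) show ?thesis by simp
qed

lemma planar_radius_le_norm:
  fixes z :: "int ^ 'd::finite"
  assumes "p \<noteq> q"
  shows "planar_radius p q z \<le> norm (lat z)"
proof -
  have "(\<Sum>k\<in>{p, q}. (lat z $ k)\<^sup>2) \<le> (\<Sum>k\<in>UNIV. (lat z $ k)\<^sup>2)"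
    by (rule sum_mono2) auto
  with assms show ?thesis
    by (simp add: planar_radius_def norm_vec_def L2_set_def lat_def)
qed

lemma norm_diff_in_planar_slice:
  assumes "p \<noteq> q" "c $ p = 0" "c $ q = 0" "lat z \<in> planar_slice p q c"
  shows "norm (lat z - lat c) = planar_radius p q z"
proof -
  have "(lat z - lat c) \<bullet> (lat z - lat c) = (real_of_int (z $ p))\<^sup>2 + (real_of_int (z $ q))\<^sup>2"
    using assms by (subst inner_planar[of p q])
      (auto simp: planar_slice_def lat_def power2_eq_square)
  then show ?thesis by (simp add: norm_eq_sqrt_inner planar_radius_def)
qed

lemma star_ray_planar:
  assumes "\<forall>k. k \<noteq> p \<and> k \<noteq> q \<longrightarrow> \<theta> $ k = 0" "k \<noteq> p" "k \<noteq> q"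
  shows "fst (star_ray p q \<theta> z) $ k = 0"
  using assms by (auto simp: star_ray_def star_direction_def axis_def)

lemma star_ray_stays_in_slice:
  assumes "\<forall>k. k \<noteq> p \<and> k \<noteq> q \<longrightarrow> \<theta> $ k = 0"
    and "lat y \<in> ray_points (star_ray p q \<theta> z)" "lat z \<in> planar_slice p q c"
  shows "lat y \<in> planar_slice p q c"
  using assms star_ray_planar[OF assms(1), of _ z]
  by (auto simp: ray_points_def planar_slice_def) (auto simp: star_ray_def split: if_splits)

lemma planar_radius_less_on_star_ray:
  assumes pq: "p \<noteq> q" and \<theta>: "\<theta> \<in> rational_directions"
    and planar: "\<forall>k. k \<noteq> p \<and> k \<noteq> q \<longrightarrow> \<theta> $ k = 0"
    and y: "lat y \<in> ray_points (star_ray p q \<theta> z)" "y \<noteq> z"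
  shows "planar_radius p q z < planar_radius p q y"
proof -
  define u where "u = fst (star_ray p q \<theta> z)"
  have snd: "snd (star_ray p q \<theta> z) = lat z" by (simp add: star_ray_def)
  obtain t where t: "lat y = lat z + t *\<^sub>R u"
    using y(1) by (auto simp: ray_points_def u_def snd)
  with y(2) have "t \<noteq> 0" by auto
  have u0: "u $ k = 0" if "k \<noteq> p" "k \<noteq> q" for k
    using star_ray_planar[OF planar that] by (simp add: u_def)
  have "norm u = 1" "lat z \<bullet> u = 0"
    using is_ray_star_ray[OF pq \<theta> planar, of z] by (simp_all add: is_ray_def snd u_def)
  then have unit: "u $ p * u $ p + u $ q * u $ q = 1"
    and orth: "lat z $ p * u $ p + lat z $ q * u $ q = 0"
    using inner_planar[OF pq u0, of u] inner_planar[OF pq u0, of "lat z"]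
    by (simp_all add: norm_eq_1)
  have "(lat y $ p)\<^sup>2 + (lat y $ q)\<^sup>2 = (lat z $ p)\<^sup>2 + (lat z $ q)\<^sup>2
      + 2 * t * (lat z $ p * u $ p + lat z $ q * u $ q) + t\<^sup>2 * (u $ p * u $ p + u $ q * u $ q)"
    unfolding t by (simp add: power2_eq_square algebra_simps)
  also have "\<dots> = (lat z $ p)\<^sup>2 + (lat z $ q)\<^sup>2 + t\<^sup>2"
    by (simp add: unit orth)
  finally show ?thesis
    using \<open>t \<noteq> 0\<close> by (simp add: planar_radius_def lat_def)
qed

lemma uniquely_determines_on_annulus:
  fixes p q :: "'d::finite" and \<theta> :: "real ^ 'd"
  assumes pq: "p \<noteq> q" and \<theta>: "\<theta> \<in> rational_directions"
    and planar: "\<forall>k. k \<noteq> p \<and> k \<noteq> q \<longrightarrow> \<theta> $ k = 0"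
    and r: "r \<le> \<beta>"
  shows "uniquely_determines_on r (star_rays_between p q \<theta> \<alpha> \<beta>) (annulus p q \<alpha> \<beta>)"
  unfolding uniquely_determines_on_def
proof (intro allI impI ballI)
  fix f g :: "int ^ 'd \<Rightarrow> complex" and z
  assume f: "supported_in_ball r f" and g: "supported_in_ball r g"
    and eq: "\<forall>\<gamma>\<in>star_rays_between p q \<theta> \<alpha> \<beta>. xray f \<gamma> = xray g \<gamma>"
    and z: "z \<in> annulus p q \<alpha> \<beta>"
  \<comment> \<open>Induction along decreasing planar radius is made well-founded by counting the
    lattice points of the ball still farther out.\<close>
  define farther where
    "farther z = {y. lat y \<in> cball 0 r \<and> planar_radius p q z < planar_radius p q y}" for z
  have fin: "finite (farther z)" for z
    unfolding farther_def by (rule finite_subset[OF _ finite_lattice_cball[of r]]) auto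
  show "f z = g z"
    using z
  proof (induction z rule: measure_induct_rule[of "\<lambda>z. card (farther z)"])
    case (less z)
    let ?\<gamma> = "star_ray p q \<theta> z"
    let ?Y = "{y. lat y \<in> ray_points ?\<gamma> \<inter> cball 0 r}"
    have finY: "finite ?Y"
      by (rule finite_subset[OF _ finite_lattice_cball[of r]]) auto
    have rest: "f y = g y" if y: "y \<in> ?Y - {z}" for y
    proof (rule less.IH)
      have lt: "planar_radius p q z < planar_radius p q y"
        using planar_radius_less_on_star_ray[OF pq \<theta> planar] y by auto
      with y have "y \<in> farther z" "y \<notin> farther y" "farther y \<subseteq> farther z"
        by (auto simp: farther_def)
      then show "card (farther y) < card (farther z)"
        by (intro psubset_card_mono fin) auto
      show "y \<in> annulus p q \<alpha> \<beta>"
        using lt less.prems y r planar_radius_le_norm[OF pq, of y] by (auto simp: annulus_def)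
    qed
    show "f z = g z"
    proof (cases "lat z \<in> cball 0 r")
      case True
      then have "z \<in> ?Y" by (simp add: lat_mem_star_ray)
      have "?\<gamma> \<in> star_rays_between p q \<theta> \<alpha> \<beta>"
        using less.prems by (auto simp: star_rays_between_def annulus_def)
      with eq have "xray f ?\<gamma> = xray g ?\<gamma>" by blast
      then have "sum f ?Y = sum g ?Y"
        by (simp only: xray_eq_sum[OF f] xray_eq_sum[OF g])
      moreover have "sum f (?Y - {z}) = sum g (?Y - {z})"
        by (rule sum.cong) (use rest in auto)
      ultimately show ?thesis
        using sum.remove[OF finY \<open>z \<in> ?Y\<close>, of f] sum.remove[OF finY \<open>z \<in> ?Y\<close>, of g] by simp
    next
      case False
      with f g show ?thesis by (force simp: supported_in_ball_def)
    qed
  qed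
qed

lemma uniquely_determines_on_all:
  fixes p q :: "'d::finite" and \<theta> :: "real ^ 'd"
  assumes "p \<noteq> q" "\<theta> \<in> rational_directions" "\<forall>k. k \<noteq> p \<and> k \<noteq> q \<longrightarrow> \<theta> $ k = 0"
  shows "uniquely_determines_on r (star_rays p q \<theta>) UNIV"
  unfolding uniquely_determines_on_def
proof (intro allI impI ballI)
  fix f g :: "int ^ 'd \<Rightarrow> complex" and z
  assume fg: "supported_in_ball r f" "supported_in_ball r g"
    and eq: "\<forall>\<gamma>\<in>star_rays p q \<theta>. xray f \<gamma> = xray g \<gamma>"
  define \<beta> where "\<beta> = max r (planar_radius p q z)"
  have "uniquely_determines_on r (star_rays_between p q \<theta> 0 \<beta>) (annulus p q 0 \<beta>)"
    by (rule uniquely_determines_on_annulus) (use assms in \<open>simp_all add: \<beta>_def\<close>)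
  moreover have "z \<in> annulus p q 0 \<beta>"
    by (simp add: annulus_def \<beta>_def planar_radius_def)
  moreover have "star_rays_between p q \<theta> 0 \<beta> \<subseteq> star_rays p q \<theta>"
    by (auto simp: star_rays_between_def star_rays_def)
  ultimately show "f z = g z"
    using fg eq unfolding uniquely_determines_on_def by blast
qed

lemma layer_subset: "layer E x0 i \<subseteq> E"
  by (subst layer.simps) auto

text \<open>For \<open>i = 1\<close> the sum is empty, so both reconstruction formulas are covered.\<close>

lemma layer_reconstruction:
  fixes p q :: "'d::finite" and \<theta> :: "real ^ 'd"
  assumes pq: "p \<noteq> q" and \<theta>: "\<theta> \<in> rational_directions"
    and planar: "\<forall>k. k \<noteq> p \<and> k \<noteq> q \<longrightarrow> \<theta> $ k = 0"
    and f: "supported_in_ball r f"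
    and c: "c $ p = 0" "c $ q = 0"
    and E: "E = cball 0 r \<inter> planar_slice p q c \<inter> range lat"
    and z: "lat z \<in> layer E (lat c) i"
  shows "f z = xray f (star_ray p q \<theta> z) -
    (\<Sum>\<zeta> | lat \<zeta> \<in> ray_points (star_ray p q \<theta> z) \<inter> (\<Union>k\<in>{1..<i}. layer E (lat c) k). f \<zeta>)"
proof -
  let ?\<gamma> = "star_ray p q \<theta> z"
  let ?U = "\<Union>k\<in>{1..<i}. layer E (lat c) k"
  let ?Y = "{y. lat y \<in> ray_points ?\<gamma> \<inter> cball 0 r}"
  have finY: "finite ?Y"
    by (rule finite_subset[OF _ finite_lattice_cball[of r]]) auto
  have zE: "lat z \<in> E" "lat z \<notin> ?U"
    and zmax: "\<forall>x\<in>E - ?U. norm (x - lat c) \<le> norm (lat z - lat c)"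
    using z unfolding layer.simps[of E "lat c" i] by simp_all
  have zY: "z \<in> ?Y" using zE by (simp add: E lat_mem_star_ray)
  have "lat y \<in> ?U" if y: "y \<in> ?Y" "y \<noteq> z" for y
  proof (rule ccontr)
    assume "lat y \<notin> ?U"
    have slice: "lat z \<in> planar_slice p q c" "lat y \<in> planar_slice p q c"
      using zE y star_ray_stays_in_slice[OF planar, of y z c] by (auto simp: E)
    with y have "lat y \<in> E" by (simp add: E)
    with \<open>lat y \<notin> ?U\<close> zmax have "norm (lat y - lat c) \<le> norm (lat z - lat c)"
      by blast
    then have "planar_radius p q y \<le> planar_radius p q z"
      by (simp add: norm_diff_in_planar_slice[OF pq c] slice)
    then show False
      using planar_radius_less_on_star_ray[OF pq \<theta> planar, of y z] y by simp
  qed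
  moreover have "?U \<subseteq> cball 0 r"
    using layer_subset[of E "lat c"] by (auto simp: E)
  ultimately have "{\<zeta>. lat \<zeta> \<in> ray_points ?\<gamma> \<inter> ?U} = ?Y - {z}"
    using zE by blast
  moreover have "xray f ?\<gamma> = f z + sum f (?Y - {z})"
    unfolding xray_eq_sum[OF f] by (rule sum.remove[OF finY zY])
  ultimately show ?thesis by simp
qed

theorem theorem2p1:
  fixes p q :: "'d::finite"
    and \<theta> :: "real ^ 'd"
    and r :: real
    and f :: "int ^ 'd \<Rightarrow> complex"
  assumes "p \<noteq> q"
    and "\<theta> \<in> rational_directions"
    and "\<forall>k. k \<noteq> p \<and> k \<noteq> q \<longrightarrow> \<theta> $ k = 0"
    and "r > 0"
    and "supported_in_ball r f"
  shows "uniquely_determines_on r (star_rays p q \<theta>) UNIV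
    \<and> (\<forall>c E x0. c $ p = 0 \<and> c $ q = 0 \<and>
          E = cball 0 r \<inter> planar_slice p q c \<inter> range lat \<and> x0 = lat c \<and> E \<noteq> {} \<longrightarrow>
          (\<forall>z. lat z \<in> layer E x0 1 \<longrightarrow> f z = xray f (star_ray p q \<theta> z)) \<and>
          (\<forall>i\<in>{1..layer_count E x0 - 1}. \<forall>z. lat z \<in> layer E x0 (i + 1) \<longrightarrow>
             f z = xray f (star_ray p q \<theta> z) -
               (\<Sum>\<zeta>\<in>{\<zeta>. lat \<zeta> \<in> ray_points (star_ray p q \<theta> z) \<inter> (\<Union>k\<in>{1..i}. layer E x0 k)}. f \<zeta>)))
    \<and> (\<forall>\<alpha> \<beta>. 0 \<le> \<alpha> \<and> \<alpha> \<le> \<beta> \<and> r \<le> \<beta> \<longrightarrow>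
          uniquely_determines_on r (star_rays_between p q \<theta> \<alpha> \<beta>) (annulus p q \<alpha> \<beta>))"
proof (intro conjI allI impI ballI)
  show "uniquely_determines_on r (star_rays p q \<theta>) UNIV"
    by (rule uniquely_determines_on_all[OF assms(1-3)])
next
  fix c E x0 z
  assume "c $ p = 0 \<and> c $ q = 0 \<and>
      E = cball 0 r \<inter> planar_slice p q c \<inter> range lat \<and> x0 = lat c \<and> E \<noteq> {}"
  then have c: "c $ p = 0" "c $ q = 0"
    and E: "E = cball 0 r \<inter> planar_slice p q c \<inter> range lat" and x0: "x0 = lat c"
    by blast+
  assume z: "lat z \<in> layer E x0 1"
  show "f z = xray f (star_ray p q \<theta> z)"
    using layer_reconstruction[OF assms(1-3,5) c E z[unfolded x0]] by simp
next
  fix c E x0 i z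
  assume "c $ p = 0 \<and> c $ q = 0 \<and>
      E = cball 0 r \<inter> planar_slice p q c \<inter> range lat \<and> x0 = lat c \<and> E \<noteq> {}"
  then have c: "c $ p = 0" "c $ q = 0"
    and E: "E = cball 0 r \<inter> planar_slice p q c \<inter> range lat" and x0: "x0 = lat c"
    by blast+
  assume z: "lat z \<in> layer E x0 (i + 1)"
  have "{1..<i + 1} = {1..i}" by auto
  then show "f z = xray f (star_ray p q \<theta> z) -
      (\<Sum>\<zeta>\<in>{\<zeta>. lat \<zeta> \<in> ray_points (star_ray p q \<theta> z) \<inter> (\<Union>k\<in>{1..i}. layer E x0 k)}. f \<zeta>)"
    using layer_reconstruction[OF assms(1-3,5) c E z[unfolded x0]] by (simp only: x0)
next
  fix \<alpha> \<beta> :: real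
  assume "0 \<le> \<alpha> \<and> \<alpha> \<le> \<beta> \<and> r \<le> \<beta>"
  then show "uniquely_determines_on r (star_rays_between p q \<theta> \<alpha> \<beta>) (annulus p q \<alpha> \<beta>)"
    by (intro uniquely_determines_on_annulus[OF assms(1-3)]) simp
qed

end
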